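(* For every number of spheres $n\ge 2$ and every dimension $d\ge 2$, the maximal radius function $G:[0,1]^{nd}\to[0,\infty)$ for $n$ points in the $d$-dimensional unit cube has finitely many local maxima.
   Context: Let $|\cdot|$ denote the Euclidean norm. Write $\mathbf{x}=(\mathbf{x}_1,\dots,\mathbf{x}_n)=(x_{11},\dots,x_{1d},\dots,x_{n1},\dots,x_{nd})$ for a collection of $n$ points $\mathbf{x}_i\in\mathbb{R}^d$. Maximal radius function: for $\mathbf{x}\in[0,1]^{nd}$, $G(\mathbf{x})$ is the minimum of the following finite collection of numbers: $\frac{|\mathbf{x}_i-\mathbf{x}_j|}{2}$ for $1\le i<j\le n$, and $x_{ik}$ and $1-x_{ik}$ for $1\le i\le n$, $1\le k\le d$. Equivalently, $G(\mathbf{x})$ is the maximal $r$ such that a sphere of radius $r$ can be centered at every point $\mathbf{x}_i$ without violating any of the other spheres or the walls of the unit cube. A point $\mathbf{x}^*\in[0,1]^{nd}$ is a local maximum of $G$ if there is $\delta>0$ such that $G(\mathbf{x})\le G(\mathbf{x}^* )$ for all $\mathbf{x}\in[0,1]^{nd}$, $\mathbf{x}\ne\mathbf{x}^*$, with $|\mathbf{x}-\mathbf{x}^*|<\delta$.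
   Formalization: Local maxima are counted by their values of G and by the connected components of the set of local maximum points, not as points; the count of points can be infinite, since a sphere with room to move (e.g. n=33, d=5) can be shifted without changing G. *)

theory Defs
  imports "HOL-Analysis.Analysis"
begin

text \<open>
  A configuration of \<open>n\<close> points in \<open>d\<close>-dimensional space is an element \<open>x\<close> of
  \<^typ>\<open>real ^ 'd ^ 'n\<close> with \<open>n = CARD('n)\<close> and \<open>d = CARD('d)\<close>: the \<open>i\<close>-th point is \<open>x $ i\<close>.
  The norm on this type is the Euclidean norm of the vector of all \<open>n * d\<close> coordinates.
\<close>

definition unit_cube :: "(real ^ 'd ^ 'n) set" where
  "unit_cube = {x. \<forall>i k. 0 \<le> x $ i $ k \<and> x $ i $ k \<le> 1}"

text \<open>
  The index type carries no order; since the distance is symmetric, the pairs \<open>i \<noteq> j\<close> give the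
  same set of numbers as the pairs \<open>i < j\<close>.
\<close>

definition max_radius :: "real ^ 'd ^ 'n \<Rightarrow> real" where
  "max_radius x = Min ({norm (x $ i - x $ j) / 2 | i j. i \<noteq> j}
     \<union> {x $ i $ k | i k. True} \<union> {1 - x $ i $ k | i k. True})"

definition is_local_maximum :: "real ^ 'd ^ 'n \<Rightarrow> bool" where
  "is_local_maximum x \<longleftrightarrow> x \<in> unit_cube \<and>
     (\<exists>\<delta>>0. \<forall>y\<in>unit_cube. y \<noteq> x \<and> norm (y - x) < \<delta> \<longrightarrow> max_radius y \<le> max_radius x)"

lemma max_radius_nonneg:
  fixes x :: "real ^ 'd ^ 'n"
  assumes "x \<in> unit_cube"
  shows "0 \<le> max_radius x"
proof -
  let ?A = "{norm (x $ i - x $ j) / 2 | i j. i \<noteq> j}"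
  let ?B = "{x $ i $ k | i k. True}"
  let ?C = "{1 - x $ i $ k | i k. True}"
  have "?A \<subseteq> (\<lambda>(i, j). norm (x $ i - x $ j) / 2) ` UNIV"
    and "?B \<subseteq> (\<lambda>(i, k). x $ i $ k) ` UNIV"
    and "?C \<subseteq> (\<lambda>(i, k). 1 - x $ i $ k) ` UNIV"
    by (force simp: image_iff)+
  then have "finite (?A \<union> ?B \<union> ?C)"
    by (meson finite_UnI finite_code finite_imageI finite_subset)
  moreover have "?A \<union> ?B \<union> ?C \<noteq> {}"
    by auto
  moreover have "\<forall>a \<in> ?A \<union> ?B \<union> ?C. 0 \<le> a"
    using assms by (auto simp: unit_cube_def simp del: eq_divide_eq_numeral1)
  ultimately show ?thesis
    unfolding max_radius_def by (subst Min_ge_iff) auto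
qed

text \<open>
  The inequality is not strict, and the set of points satisfying \<^const>\<open>is_local_maximum\<close> is
  infinite for some \<open>n\<close> and \<open>d\<close>: a sphere with room to move (a rattler) can change its position
  without affecting the radius. Local maxima are therefore counted by their values and by the
  connected components of the set of these points, not by its cardinality.
\<close>

end

theory Submission
  imports Defs
begin

text \<open>
  The radius is a minimum of finitely many convex functions. If \<open>x\<close> and \<open>y\<close> are local maxima with
  the same active constraints, move \<open>x\<close> away from \<open>y\<close> along the line through them: by convexity the
  radius grows at least at the rate of its difference between \<open>x\<close> and \<open>y\<close>. So the two values agree,
  and there are at most as many values as active sets. If moreover \<open>x\<close> and \<open>y\<close> differ in an active
  difference vector, that constraint becomes inactive along the motion while local maximality persists.
  Hence every local maximum is connected to a stratum on which the active difference vectors are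
  constant. Such a stratum is cut out of an affine subspace by fewer strict inequalities
  \<open>f\<^sub>a > r\<close>. By induction on the number of constraints it has finitely many components, because each
  component of \<open>{min f\<^sub>a > r}\<close> contains a local maximum of \<open>min f\<^sub>a\<close>.
\<close>

section \<open>Counting components by representatives\<close>

text \<open>Representatives make finiteness transferable: when every point of a set is joined within
  it to some point of a subset, representatives for the subset also represent the whole set.\<close>

lemma finite_components_iff:
  fixes S :: "'a::topological_space set"
  shows "finite (components S) \<longleftrightarrow>
    (\<exists>R. finite R \<and> R \<subseteq> S \<and> (\<forall>x\<in>S. \<exists>y\<in>R. connected_component S x y))"
proof
  assume fin: "finite (components S)"
  define p where "p K = (SOME x. x \<in> K)" for K :: "'a set"
  have p: "p K \<in> K" if "K \<in> components S" for K
    unfolding p_def using in_components_nonempty[OF that] by (simp add: some_in_eq)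
  have "\<exists>y\<in>p ` components S. connected_component S x y" if "x \<in> S" for x
    using p[OF componentsI[OF that]] componentsI[OF that] by auto
  moreover have "p ` components S \<subseteq> S"
    using p in_components_subset by blast
  ultimately show "\<exists>R. finite R \<and> R \<subseteq> S \<and> (\<forall>x\<in>S. \<exists>y\<in>R. connected_component S x y)"
    using fin by blast
next
  assume "\<exists>R. finite R \<and> R \<subseteq> S \<and> (\<forall>x\<in>S. \<exists>y\<in>R. connected_component S x y)"
  then obtain R where R: "finite R" "\<And>x. x \<in> S \<Longrightarrow> \<exists>y\<in>R. connected_component S x y"
    by blast
  have "components S \<subseteq> connected_component_set S ` R"
  proof
    fix K assume "K \<in> components S"
    then obtain x where x: "x \<in> S" "K = connected_component_set S x"
      by (auto simp: components_def)
    with R(2) obtain y where "y \<in> R" "connected_component S x y"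
      by blast
    then show "K \<in> connected_component_set S ` R"
      using x(2) connected_component_eq[of y S x] by blast
  qed
  then show "finite (components S)"
    using R(1) finite_surj by blast
qed

lemma isCont_eventually_gr:
  fixes g :: "'a::t2_space \<Rightarrow> real"
  assumes "isCont g x" "c < g x"
  shows "\<forall>\<^sub>F y in nhds x. c < g y"
  using assms unfolding continuous_at tendsto_at_iff_tendsto_nhds by (rule order_tendstoD)

section \<open>Minima of finitely many convex functions\<close>

text \<open>
  The map \<open>P a\<close> records the part of a point on which \<open>f a\<close> depends. Convexity appears in the form
  of extrapolation beyond the segment from \<open>y\<close> to \<open>x\<close>.
\<close>

locale convex_family =
  fixes f :: "'i \<Rightarrow> 'a::euclidean_space \<Rightarrow> real"
    and P :: "'i \<Rightarrow> 'a \<Rightarrow> 'b::real_vector"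
  assumes lin: "linear (P a)"
    and cont: "continuous_on UNIV (f a)"
    and factor: "P a x = P a y \<Longrightarrow> f a x = f a y"
    and extrapolate: "0 \<le> t \<Longrightarrow> f a x + t * (f a x - f a y) \<le> f a (x + t *\<^sub>R (x - y))"
    and extrapolate_strict:
      "0 < t \<Longrightarrow> f a x = f a y \<Longrightarrow> P a x \<noteq> P a y \<Longrightarrow> f a x < f a (x + t *\<^sub>R (x - y))"
begin

definition lower :: "'i set \<Rightarrow> 'a \<Rightarrow> real" where
  "lower A x = Min ((\<lambda>a. f a x) ` A)"

definition active :: "'i set \<Rightarrow> 'a \<Rightarrow> 'i set" where
  "active A x = {a \<in> A. f a x = lower A x}"

definition local_max :: "'a set \<Rightarrow> 'i set \<Rightarrow> 'a \<Rightarrow> bool" where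
  "local_max X A x \<longleftrightarrow>
     x \<in> X \<and> (\<exists>\<delta>>0. \<forall>y\<in>X. dist y x < \<delta> \<longrightarrow> lower A y \<le> lower A x)"

text \<open>The value set \<open>J\<close> is a parameter because two choices occur:
  \<open>{c<..}\<close> in the induction on superlevel sets and \<open>{0..}\<close> for
  configurations in the cube.\<close>

definition maxima :: "'a set \<Rightarrow> 'i set \<Rightarrow> real set \<Rightarrow> 'a set" where
  "maxima X A J = {x. local_max X A x \<and> lower A x \<in> J}"

text \<open>Quantifying over the constraints, instead of using \<open>c < lower A y\<close>, gives
  the empty family its intended meaning, the whole of \<open>X\<close>. Removing all active
  constraints may leave that family.\<close>

definition super :: "'a set \<Rightarrow> 'i set \<Rightarrow> real \<Rightarrow> 'a set" where
  "super X A c = {y \<in> X. \<forall>a\<in>A. c < f a y}"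

lemma lower_le: "finite A \<Longrightarrow> a \<in> A \<Longrightarrow> lower A x \<le> f a x"
  by (simp add: lower_def)

lemma lower_ge_iff: "finite A \<Longrightarrow> A \<noteq> {} \<Longrightarrow> c \<le> lower A x \<longleftrightarrow> (\<forall>a\<in>A. c \<le> f a x)"
  by (simp add: lower_def)

lemma lower_gr_iff: "finite A \<Longrightarrow> A \<noteq> {} \<Longrightarrow> c < lower A x \<longleftrightarrow> (\<forall>a\<in>A. c < f a x)"
  by (simp add: lower_def)

lemma lower_attained: "finite A \<Longrightarrow> A \<noteq> {} \<Longrightarrow> \<exists>a\<in>A. f a x = lower A x"
  unfolding lower_def using Min_in[of "(\<lambda>a. f a x) ` A"] by (auto simp: image_iff)

lemma active_subset: "active A x \<subseteq> A"
  by (auto simp: active_def)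

lemma active_nonempty: "finite A \<Longrightarrow> A \<noteq> {} \<Longrightarrow> active A x \<noteq> {}"
  using lower_attained by (fastforce simp: active_def)

lemma inactive_gr: "finite A \<Longrightarrow> a \<in> A - active A x \<Longrightarrow> lower A x < f a x"
  using lower_le[of A a x] by (auto simp: active_def)

lemma isCont_f: "isCont (f a) x"
  using cont continuous_on_eq_continuous_at by blast

lemma continuous_on_lower:
  assumes "finite A" "A \<noteq> {}"
  shows "continuous_on S (lower A)"
  using assms
proof (induction A rule: finite_ne_induct)
  case (singleton a)
  then show ?case
    using continuous_on_subset[OF cont] by (simp add: lower_def)
next
  case (insert a A)
  then have "lower (insert a A) x = min (f a x) (lower A x)" for x
    by (simp add: lower_def)
  then show ?case
    using insert.IH continuous_on_min[OF continuous_on_subset[OF cont]]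
    by (metis (no_types, lifting) continuous_on_cong subset_UNIV)
qed

lemma local_maxD:
  assumes "local_max X A x"
  obtains \<delta> where "\<delta> > 0" "\<And>y. y \<in> X \<Longrightarrow> dist y x < \<delta> \<Longrightarrow> lower A y \<le> lower A x"
  using assms unfolding local_max_def by blast

section \<open>Extrapolation between points with the same active set\<close>

text \<open>At \<open>t = 0\<close> this is the strictness of an inactive constraint; continuity
  keeps it for small \<open>t\<close>, and finiteness of \<open>A\<close> allows one
  \<open>\<epsilon>\<close> for all.\<close>

lemma extrapolation_near:
  assumes "finite A" "active A y = active A x"
  obtains \<epsilon> where "\<epsilon> > 0"
    "\<And>t a. 0 \<le> t \<Longrightarrow> t \<le> \<epsilon> \<Longrightarrow> a \<in> A - active A x \<Longrightarrow>
        lower A x + t * (lower A x - lower A y) < f a (x + t *\<^sub>R (x - y))"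
proof -
  let ?g = "\<lambda>a t. f a (x + t *\<^sub>R (x - y)) - t * (lower A x - lower A y)"
  have "\<forall>\<^sub>F t in nhds 0. lower A x < ?g a t" if "a \<in> A - active A x" for a
  proof -
    have "isCont (?g a) 0"
      by (intro continuous_intros isCont_o2[OF _ isCont_f])
    then show ?thesis
      using inactive_gr[OF assms(1) that] by (intro isCont_eventually_gr) simp_all
  qed
  then have "\<forall>\<^sub>F t in nhds 0. \<forall>a \<in> A - active A x. lower A x < ?g a t"
    using assms(1) by (simp add: eventually_ball_finite)
  then obtain e where e: "e > 0"
    "\<And>t. dist t 0 < e \<Longrightarrow> \<forall>a \<in> A - active A x. lower A x < ?g a t"
    unfolding eventually_nhds_metric by blast
  show ?thesis
  proof (rule that[of "e / 2"])
    show "e / 2 > 0"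
      using e(1) by simp
    fix t a
    assume "0 \<le> t" "t \<le> e / 2" "a \<in> A - active A x"
    then show "lower A x + t * (lower A x - lower A y) < f a (x + t *\<^sub>R (x - y))"
      using e(1) e(2)[of t] by (simp add: dist_real_def algebra_simps)
  qed
qed

text \<open>An active constraint equals \<open>lower A\<close> at both \<open>x\<close> and
  \<open>y\<close>, so its own extrapolation inequality is the claimed one; near \<open>x\<close>
  the inactive constraints stay above that bound.\<close>

lemma lower_extrapolate:
  assumes A: "finite A" "A \<noteq> {}" and act: "active A y = active A x"
  obtains \<epsilon> where "\<epsilon> > 0"
    "\<And>t. 0 \<le> t \<Longrightarrow> t \<le> \<epsilon> \<Longrightarrow>
        lower A x + t * (lower A x - lower A y) \<le> lower A (x + t *\<^sub>R (x - y))"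
proof -
  obtain \<epsilon> where \<epsilon>: "\<epsilon> > 0"
    "\<And>t a. 0 \<le> t \<Longrightarrow> t \<le> \<epsilon> \<Longrightarrow> a \<in> A - active A x \<Longrightarrow>
        lower A x + t * (lower A x - lower A y) < f a (x + t *\<^sub>R (x - y))"
    using extrapolation_near[OF A(1) act] by blast
  have "lower A x + t * (lower A x - lower A y) \<le> lower A (x + t *\<^sub>R (x - y))"
    if t: "0 \<le> t" "t \<le> \<epsilon>" for t
    unfolding lower_ge_iff[OF A]
  proof
    fix a assume a: "a \<in> A"
    show "lower A x + t * (lower A x - lower A y) \<le> f a (x + t *\<^sub>R (x - y))"
    proof (cases "a \<in> active A x")
      case True
      then have "f a x = lower A x" "f a y = lower A y"
        using act by (auto simp: active_def)
      then show ?thesis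
        using extrapolate[OF t(1), of a x y] by simp
    next
      case False
      then show ?thesis
        using \<epsilon>(2)[OF t, of a] a by simp
    qed
  qed
  with \<epsilon>(1) that show ?thesis
    by blast
qed

lemma affine_extrapolate:
  assumes "affine X" "x \<in> X" "y \<in> X"
  shows "x + t *\<^sub>R (x - y) \<in> X"
proof -
  have "x + t *\<^sub>R (x - y) = (1 + t) *\<^sub>R x + (- t) *\<^sub>R y"
    by (simp add: algebra_simps)
  also have "\<dots> \<in> X"
    using assms unfolding affine_def by (metis add.right_neutral add.assoc add.right_inverse)
  finally show ?thesis .
qed

lemma extrapolate_close:
  fixes x y :: 'a
  assumes "\<delta> > 0"
  obtains \<epsilon> where "\<epsilon> > 0" "\<And>t. 0 \<le> t \<Longrightarrow> t \<le> \<epsilon> \<Longrightarrow> dist (x + t *\<^sub>R (x - y)) x < \<delta>"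
\<comment> \<open>The summand 1 keeps the denominator positive when \<open>x = y\<close>.\<close>
proof (rule that[of "\<delta> / (norm (x - y) + 1)"])
  have pos: "norm (x - y) + 1 > 0"
    by (smt (verit) norm_ge_zero)
  then show "\<delta> / (norm (x - y) + 1) > 0"
    using assms by simp
  fix t :: real
  assume t: "0 \<le> t" "t \<le> \<delta> / (norm (x - y) + 1)"
  have "t * norm (x - y) < \<delta>"
  proof (cases "t = 0")
    case False
    then have "t * norm (x - y) < t * (norm (x - y) + 1)"
      using t(1) by simp
    also have "\<dots> \<le> \<delta>"
      using t(2) pos by (simp add: field_simps)
    finally show ?thesis .
  qed (use assms in simp)
  then show "dist (x + t *\<^sub>R (x - y)) x < \<delta>"
    using t(1) by (simp add: dist_norm)
qed

text \<open>If the value at \<open>x\<close> were larger, stepping from \<open>x\<close> directly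
  away from \<open>y\<close> would raise the minimum at once. For two local maxima, exchanging the
  roles gives equality.\<close>

lemma local_max_value_le:
  assumes A: "finite A" "A \<noteq> {}" and X: "affine X"
    and x: "local_max X A x" and y: "y \<in> X" and act: "active A y = active A x"
  shows "lower A x \<le> lower A y"
proof (rule ccontr)
  assume less: "\<not> ?thesis"
  have xX: "x \<in> X"
    using x by (simp add: local_max_def)
  obtain \<delta> where \<delta>: "\<delta> > 0" "\<And>z. z \<in> X \<Longrightarrow> dist z x < \<delta> \<Longrightarrow> lower A z \<le> lower A x"
    using local_maxD[OF x] by blast
  obtain e1 where e1: "e1 > 0" "\<And>t. 0 \<le> t \<Longrightarrow> t \<le> e1 \<Longrightarrow>
      lower A x + t * (lower A x - lower A y) \<le> lower A (x + t *\<^sub>R (x - y))"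
    using lower_extrapolate[OF A act] by blast
  obtain e2 where e2: "e2 > 0" "\<And>t. 0 \<le> t \<Longrightarrow> t \<le> e2 \<Longrightarrow> dist (x + t *\<^sub>R (x - y)) x < \<delta>"
    using extrapolate_close[OF \<delta>(1)] by blast
  let ?t = "min e1 e2"
  have "?t > 0"
    using e1(1) e2(1) by simp
  then have "lower A x < lower A x + ?t * (lower A x - lower A y)"
    using less by simp
  also have "\<dots> \<le> lower A (x + ?t *\<^sub>R (x - y))"
    using e1(2)[of ?t] \<open>?t > 0\<close> by simp
  also have "\<dots> \<le> lower A x"
    using \<delta>(2)[OF affine_extrapolate[OF X xX y] e2(2)] \<open>?t > 0\<close> by simp
  finally show False
    by simp
qed

lemma local_max_value_eq:
  assumes "finite A" "A \<noteq> {}" "affine X"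
    and "local_max X A x" "local_max X A y" "active A y = active A x"
  shows "lower A x = lower A y"
  using assms local_max_value_le[of A X x y] local_max_value_le[of A X y x]
  by (simp add: local_max_def)

text \<open>The value at a maximum depends only on its active set, one of finitely many subsets of
  \<open>A\<close>.\<close>

lemma finite_maximal_values:
  assumes A: "finite A" "A \<noteq> {}" and X: "affine X"
  shows "finite (lower A ` maxima X A J)"
proof -
  let ?M = "maxima X A J"
  define g where "g S = lower A (SOME x. x \<in> ?M \<and> active A x = S)" for S
  have "lower A x = g (active A x)" if "x \<in> ?M" for x
  proof -
    let ?y = "SOME y. y \<in> ?M \<and> active A y = active A x"
    have "?y \<in> ?M \<and> active A ?y = active A x"
      by (rule someI[of _ x]) (use that in simp)
    then show ?thesis
      unfolding g_def using that local_max_value_eq[OF A X] by (auto simp: maxima_def)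
  qed
  then have "lower A ` ?M \<subseteq> g ` Pow A"
    using active_subset by blast
  then show ?thesis
    using A(1) finite_surj by blast
qed

section \<open>Moving maxima to rigid strata\<close>

text \<open>
  The extrapolation keeps the value but strictly increases every active constraint on which
  \<open>x\<close> and \<open>y\<close> disagree.
\<close>

lemma shrink_active:
  assumes A: "finite A" "A \<noteq> {}" and X: "affine X"
    and x: "x \<in> maxima X A J" and y: "y \<in> maxima X A J" and act: "active A y = active A x"
    and a: "a \<in> active A x" "P a x \<noteq> P a y"
  obtains z where "z \<in> maxima X A J" "connected_component (maxima X A J) x z"
    "active A z \<subset> active A x"
proof -
  have lm: "local_max X A x" "local_max X A y" and J: "lower A x \<in> J"
    using x y by (auto simp: maxima_def)
  have XX: "x \<in> X" "y \<in> X"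
    using lm by (auto simp: local_max_def)
  have eq: "lower A y = lower A x"
    using local_max_value_eq[OF A X lm act] by simp
  obtain \<delta> where \<delta>: "\<delta> > 0" "\<And>z. z \<in> X \<Longrightarrow> dist z x < \<delta> \<Longrightarrow> lower A z \<le> lower A x"
    using local_maxD[OF lm(1)] by blast
  obtain e1 where e1: "e1 > 0" "\<And>t. 0 \<le> t \<Longrightarrow> t \<le> e1 \<Longrightarrow>
      lower A x + t * (lower A x - lower A y) \<le> lower A (x + t *\<^sub>R (x - y))"
    using lower_extrapolate[OF A act] by blast
  obtain e2 where e2: "e2 > 0"
    "\<And>t. 0 \<le> t \<Longrightarrow> t \<le> e2 \<Longrightarrow> dist (x + t *\<^sub>R (x - y)) x < \<delta> / 2"
    using extrapolate_close[of "\<delta> / 2" x y] \<delta>(1) by auto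
  obtain e3 where e3: "e3 > 0"
    "\<And>t a. 0 \<le> t \<Longrightarrow> t \<le> e3 \<Longrightarrow> a \<in> A - active A x \<Longrightarrow>
        lower A x + t * (lower A x - lower A y) < f a (x + t *\<^sub>R (x - y))"
    using extrapolation_near[OF A(1) act] by blast
  define e where "e = Min {e1, e2, e3}"
  have e: "e > 0" "e \<le> e1" "e \<le> e2" "e \<le> e3"
    using e1(1) e2(1) e3(1) by (auto simp: e_def)
  define z where "z t = x + t *\<^sub>R (x - y)" for t
  have val: "lower A (z t) = lower A x" if "0 \<le> t" "t \<le> e" for t
  proof (rule antisym)
    show "lower A (z t) \<le> lower A x"
      using \<delta>(2)[OF affine_extrapolate[OF X XX]] e2(2)[of t] \<delta>(1) that e unfolding z_def by force
    show "lower A x \<le> lower A (z t)"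
      using e1(2)[of t] that e eq by (simp add: z_def)
  qed
  \<comment> \<open>The \<open>\<delta> / 2\<close>-ball about \<open>z t\<close> lies in the
    \<open>\<delta>\<close>-ball about \<open>x\<close>, where points of \<open>X\<close> have value
    at most \<open>lower A x\<close>, which is also the value at \<open>z t\<close>.\<close>
  have max: "z t \<in> maxima X A J" if t: "0 \<le> t" "t \<le> e" for t
  proof -
    have "lower A w \<le> lower A (z t)" if w: "w \<in> X" "dist w (z t) < \<delta> / 2" for w
    proof -
      have "dist (z t) x < \<delta> / 2"
        using e2(2)[of t] t e by (simp add: z_def)
      then have "dist w x < \<delta>"
        using w(2) dist_triangle[of w x "z t"] by simp
      then show ?thesis
        using \<delta>(2) w(1) val[OF t] by simp
    qed
    then have "local_max X A (z t)"
      unfolding local_max_def using affine_extrapolate[OF X XX] \<delta>(1)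
      by (metis half_gt_zero z_def)
    then show ?thesis
      using J val[OF t] by (simp add: maxima_def)
  qed
  have "connected (z ` {0..e})"
    unfolding z_def by (intro connected_continuous_image continuous_intros) simp
  moreover have "z ` {0..e} \<subseteq> maxima X A J"
    using max by auto
  moreover have "x \<in> z ` {0..e}" "z e \<in> z ` {0..e}"
    using e(1) by (force simp: z_def image_iff intro: bexI[of _ 0])+
  ultimately have cc: "connected_component (maxima X A J) x (z e)"
    unfolding connected_component_def by blast
  have "active A (z e) \<subseteq> active A x"
  proof
    fix b assume b: "b \<in> active A (z e)"
    show "b \<in> active A x"
    proof (rule ccontr)
      assume "b \<notin> active A x"
      then have "lower A x < f b (z e)"
        using e3(2)[of e b] b e eq active_subset by (fastforce simp: z_def)
      then show False
        using b val[of e] e(1) by (simp add: active_def)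
    qed
  qed
  \<comment> \<open>Strict extrapolation lifts \<open>a\<close> off the unchanged minimum, which
    makes the inclusion of active sets proper.\<close>
  moreover have "a \<notin> active A (z e)"
  proof -
    have "a \<in> active A y"
      using a(1) act by simp
    then have "f a x = f a y" "f a x = lower A x"
      using a(1) eq by (auto simp: active_def)
    then have "lower A x < f a (z e)"
      using extrapolate_strict[OF e(1) _ a(2)] by (simp add: z_def)
    then show ?thesis
      using val[of e] e(1) by (simp add: active_def)
  qed
  ultimately show ?thesis
    using that[OF max cc] a(1) e(1) by auto
qed

text \<open>In the packing these are the active sets with frozen contact vectors: no two maxima
  sharing the set permit a further shrinking step. An \<open>S\<close> without maxima qualifies
  vacuously.\<close>

definition rigid :: "'a set \<Rightarrow> 'i set \<Rightarrow> real set \<Rightarrow> 'i set \<Rightarrow> bool" where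
  "rigid X A J S \<longleftrightarrow>
     (\<forall>x\<in>maxima X A J. \<forall>y\<in>maxima X A J. active A x = S \<longrightarrow> active A y = S \<longrightarrow>
        (\<forall>a\<in>S. P a x = P a y))"

text \<open>Each failure of rigidity permits a move that loses an active constraint, so induction on
  the number of active constraints ends at a rigid set.\<close>

lemma connected_to_rigid:
  assumes A: "finite A" "A \<noteq> {}" and X: "affine X" and "x \<in> maxima X A J"
  shows "\<exists>z\<in>maxima X A J. connected_component (maxima X A J) x z \<and> rigid X A J (active A z)"
  using assms(4)
proof (induction "card (active A x)" arbitrary: x rule: less_induct)
  case less
  show ?case
  proof (cases "rigid X A J (active A x)")
    case True
    then show ?thesis
      using less.prems by (auto intro!: bexI[of _ x])
  next
    case False
    then obtain y a where y: "y \<in> maxima X A J" "active A y = active A x"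
      and a: "a \<in> active A x" "P a x \<noteq> P a y"
      unfolding rigid_def by metis
    obtain z where z: "z \<in> maxima X A J" "connected_component (maxima X A J) x z"
      "active A z \<subset> active A x"
      using shrink_active[OF A X less.prems y a] by blast
    have "card (active A z) < card (active A x)"
      using z(3) A(1) active_subset finite_subset psubset_card_mono by metis
    then show ?thesis
      using less.hyps[OF _ z(1)] z(2) connected_component_trans by metis
  qed
qed

section \<open>Rigid strata as superlevel sets\<close>

text \<open>
  Near a point of the stratum only the constraints in \<open>S\<close> matter, and those see only \<open>P a\<close>;
  so translating \<open>x\<close> to \<open>y\<close> carries local maximality over.
\<close>

lemma rigid_stratum:
  assumes A: "finite A" "A \<noteq> {}" and X: "affine X" and x: "x \<in> maxima X A J"
    and rigid: "rigid X A J (active A x)"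
  shows "{y \<in> maxima X A J. active A y = active A x} =
    super (X \<inter> {y. \<forall>a\<in>active A x. P a y = P a x}) (A - active A x) (lower A x)"
    (is "?M = ?U")
proof
  have lm: "local_max X A x" and J: "lower A x \<in> J"
    using x by (auto simp: maxima_def)
  have xX: "x \<in> X"
    using lm by (simp add: local_max_def)
  show "?M \<subseteq> ?U"
  proof
    fix y assume y: "y \<in> ?M"
    then have lmy: "local_max X A y" and act: "active A y = active A x"
      by (auto simp: maxima_def)
    have "\<forall>a\<in>active A x. P a y = P a x"
      using rigid x y unfolding rigid_def by blast
    moreover have "y \<in> X"
      using lmy by (simp add: local_max_def)
    moreover have "lower A x < f a y" if "a \<in> A - active A x" for a
      using inactive_gr[OF A(1), of a y] that act local_max_value_eq[OF A X lm lmy act] by simp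
    ultimately show "y \<in> ?U"
      by (simp add: super_def)
  qed
  show "?U \<subseteq> ?M"
  proof
    fix y assume y: "y \<in> ?U"
    then have yX: "y \<in> X" and Py: "\<And>a. a \<in> active A x \<Longrightarrow> P a y = P a x"
      and inact: "\<And>a. a \<in> A - active A x \<Longrightarrow> lower A x < f a y"
      by (auto simp: super_def)
    have fy: "f a y = lower A x" if "a \<in> active A x" for a
      using factor[OF Py[OF that]] that by (simp add: active_def)
    have val: "lower A y = lower A x"
    proof (rule antisym)
      obtain a where "a \<in> active A x"
        using active_nonempty[OF A] by blast
      then show "lower A y \<le> lower A x"
        using fy lower_le[OF A(1), of a y] active_subset by fastforce
      show "lower A x \<le> lower A y"
        unfolding lower_ge_iff[OF A] using fy inact by (metis DiffI less_eq_real_def)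
    qed
    have act: "active A y = active A x"
    proof
      show "active A y \<subseteq> active A x"
        using inact val by (force simp: active_def[of A y])
      show "active A x \<subseteq> active A y"
        using fy val active_subset[of A x] by (auto simp: active_def[of A y])
    qed
    obtain \<delta> where \<delta>: "\<delta> > 0" "\<And>z. z \<in> X \<Longrightarrow> dist z x < \<delta> \<Longrightarrow> lower A z \<le> lower A x"
      using local_maxD[OF lm] by blast
    have "\<forall>\<^sub>F z in nhds x. \<forall>a\<in>A - active A x. lower A x < f a z"
    proof (intro eventually_ball_finite ballI)
      fix a assume "a \<in> A - active A x"
      with inactive_gr[OF A(1)] have "lower A x < f a x"
        by blast
      then show "\<forall>\<^sub>F z in nhds x. lower A x < f a z"
        by (rule isCont_eventually_gr[OF isCont_f])
    qed (use A(1) in simp)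
    then obtain e where e: "e > 0"
      "\<And>z. dist z x < e \<Longrightarrow> \<forall>a\<in>A - active A x. lower A x < f a z"
      unfolding eventually_nhds_metric by blast
    have "lower A w \<le> lower A y" if w: "w \<in> X" "dist w y < min \<delta> e" for w
    proof -
      define z where "z = x + (w - y)"
      have "dist z x = dist w y"
        by (simp add: z_def dist_norm)
      moreover have "z \<in> X"
        using affine_diffs_subspace[OF X yX] mem_affine_3_minus[OF X xX w(1) yX, of 1]
        by (simp add: z_def)
      ultimately have z: "lower A z \<le> lower A x" "\<forall>a\<in>A - active A x. lower A x < f a z"
        using \<delta>(2) e(2) w(2) by auto
      obtain a where a: "a \<in> A" "f a z = lower A z"
        using lower_attained[OF A] by blast
      \<comment> \<open>Constraints inactive at \<open>x\<close> exceed \<open>lower A x\<close> at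
        \<open>z\<close>, hence also \<open>lower A z\<close>, so one attaining the minimum at
        \<open>z\<close> is active at \<open>x\<close>. Its \<open>P a\<close> agrees at
        \<open>z\<close> and \<open>w\<close> because it agrees at \<open>x\<close> and
        \<open>y\<close>.\<close>
      then have aa: "a \<in> active A x"
        using z by force
      have "P a z = P a w"
        using Py[OF aa] lin[of a] by (simp add: z_def linear_add linear_diff)
      then have "f a w = f a z"
        using factor by metis
      then show ?thesis
        using a z(1) val lower_le[OF A(1) a(1), of w] by simp
    qed
    then have "local_max X A y"
      unfolding local_max_def using yX \<delta>(1) e(1) by (metis min_less_iff_conj)
    then show "y \<in> ?M"
      using act val J by (simp add: maxima_def)
  qed
qed

lemma affine_fibre: "affine {y. \<forall>a\<in>S. P a y = P a x}"
  unfolding affine_def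
  by (auto simp: linear_add[OF lin] linear_scale[OF lin] simp flip: scaleR_left.add)

text \<open>Every maximum is joined to one of finitely many rigid strata. A nonempty stratum is a
  \<open>super\<close> set over \<open>A - S\<close> with \<open>S\<close> nonempty, so
  \<open>IH\<close> covers it. Assuming \<open>IH\<close> lets the same argument serve both the
  induction and the final result.\<close>

lemma finite_components_maxima_step:
  assumes A: "finite A" "A \<noteq> {}" and X: "affine X"
    and bdd: "bounded {y \<in> X. lower A y \<in> J}"
    and IH: "\<And>B Y c. B \<subset> A \<Longrightarrow> affine Y \<Longrightarrow> bounded (super Y B c) \<Longrightarrow>
      finite (components (super Y B c))"
  shows "finite (components (maxima X A J))"
proof -
  let ?M = "maxima X A J"
  let ?N = "\<lambda>S. {y \<in> ?M. active A y = S}"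
  have "\<exists>R. finite R \<and> R \<subseteq> ?N S \<and> (\<forall>x\<in>?N S. \<exists>y\<in>R. connected_component (?N S) x y)"
    if S: "rigid X A J S" for S
  proof (cases "?N S = {}")
    case False
    then obtain x where x: "x \<in> ?M" "active A x = S"
      by blast
    let ?Y = "X \<inter> {y. \<forall>a\<in>S. P a y = P a x}"
    have N: "?N S = super ?Y (A - S) (lower A x)"
      using rigid_stratum[OF A X x(1)] S x(2) by simp
    have "?N S \<subseteq> {y \<in> X. lower A y \<in> J}"
      by (auto simp: maxima_def local_max_def)
    then have "bounded (super ?Y (A - S) (lower A x))"
      unfolding N[symmetric] using bdd bounded_subset by blast
    moreover have "A - S \<subset> A"
      using active_nonempty[OF A, of x] active_subset[of A x] x(2) by blast
    ultimately have "finite (components (?N S))"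
      unfolding N using IH affine_Int[OF X affine_fibre] by blast
    then show ?thesis
      unfolding finite_components_iff .
  qed blast
  then have "\<forall>S\<in>Collect (rigid X A J). \<exists>R. finite R \<and> R \<subseteq> ?N S \<and>
      (\<forall>x\<in>?N S. \<exists>y\<in>R. connected_component (?N S) x y)"
    by simp
  from bchoice[OF this] obtain R where
    "\<forall>S\<in>Collect (rigid X A J). finite (R S) \<and> R S \<subseteq> ?N S \<and>
      (\<forall>x\<in>?N S. \<exists>y\<in>R S. connected_component (?N S) x y)" ..
  then have R: "\<And>S. rigid X A J S \<Longrightarrow> finite (R S)"
    "\<And>S. rigid X A J S \<Longrightarrow> R S \<subseteq> ?N S"
    "\<And>S x. rigid X A J S \<Longrightarrow> x \<in> ?N S \<Longrightarrow> \<exists>y\<in>R S. connected_component (?N S) x y"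
    by simp_all
  let ?R = "\<Union>S\<in>{S. S \<subseteq> A \<and> rigid X A J S}. R S"
  have "finite ?R"
    using A(1) R(1) by auto
  moreover have "?R \<subseteq> ?M"
    using R(2) by blast
  moreover have "\<exists>y\<in>?R. connected_component ?M x y" if x: "x \<in> ?M" for x
  proof -
    obtain z where z: "z \<in> ?M" "connected_component ?M x z" "rigid X A J (active A z)"
      using connected_to_rigid[OF A X x] by blast
    then obtain y where y: "y \<in> R (active A z)" "connected_component (?N (active A z)) z y"
      using R(3)[OF z(3), of z] by blast
    then have "connected_component ?M z y"
      using connected_component_of_subset[OF y(2), of ?M] by blast
    then have "connected_component ?M x y"
      using z(2) connected_component_trans by metis
    then show ?thesis
      using y(1) z(3) active_subset by blast
  qed
  ultimately show ?thesis
    unfolding finite_components_iff by (intro exI[of _ ?R] conjI ballI)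
qed

section \<open>Components of superlevel sets\<close>

text \<open>On the compact closure of \<open>K\<close>, \<open>lower A\<close> attains a maximum.
  Its value exceeds \<open>c\<close>, so the point lies in the superlevel set, and in
  \<open>K\<close> because components are relatively closed.\<close>

lemma component_contains_maximum:
  assumes A: "finite A" "A \<noteq> {}" and X: "affine X" and bdd: "bounded (super X A c)"
    and K: "K \<in> components (super X A c)"
  shows "\<exists>m\<in>K. m \<in> maxima X A {c<..}"
proof -
  let ?U = "super X A c"
  have U: "?U = {y \<in> X. c < lower A y}"
    by (auto simp: super_def lower_gr_iff[OF A])
  have KU: "K \<subseteq> ?U"
    using K by (rule in_components_subset)
  obtain u where u: "u \<in> K"
    using in_components_nonempty[OF K] by blast
  have "bounded K"
    using bdd KU bounded_subset by blast
  then have "compact (closure K)"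
    by (simp add: compact_closure)
  moreover have "closure K \<noteq> {}"
    using u by auto
  ultimately obtain m where m: "m \<in> closure K" "\<And>y. y \<in> closure K \<Longrightarrow> lower A y \<le> lower A m"
    using continuous_attains_sup[OF _ _ continuous_on_lower[OF A]] by blast
  have "closure K \<subseteq> X"
    using affine_closed[OF X] KU by (intro closure_minimal) (auto simp: super_def)
  moreover have cm: "c < lower A m"
    using m(2)[of u] u KU closure_subset[of K] U by fastforce
  ultimately have mU: "m \<in> ?U"
    using m(1) U by blast
  have "closedin (top_of_set ?U) K"
    using K by (rule closedin_component)
  then obtain T where T: "closed T" "K = ?U \<inter> T"
    unfolding closedin_closed by blast
  then have "closure K \<subseteq> T"
    by (intro closure_minimal) auto
  then have mK: "m \<in> K"
    using m(1) mU T(2) by blast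
  have "isCont (lower A) m"
    using continuous_on_lower[OF A, of UNIV] continuous_on_eq_continuous_at by blast
  then have "\<forall>\<^sub>F y in nhds m. c < lower A y"
    using cm by (rule isCont_eventually_gr)
  then obtain e where e: "e > 0" "\<And>y. dist y m < e \<Longrightarrow> c < lower A y"
    unfolding eventually_nhds_metric by blast
  \<comment> \<open>A small ball cut with the affine set \<open>X\<close> is convex and, by the
    choice of \<open>e\<close>, inside \<open>?U\<close>. It therefore lies in the component of
    \<open>m\<close>, which makes the maximum over \<open>K\<close> a local maximum in
    \<open>X\<close>.\<close>
  have "connected (X \<inter> ball m e)"
    using X by (intro convex_connected convex_Int) (auto intro: affine_imp_convex)
  moreover have "X \<inter> ball m e \<subseteq> ?U"
    using e(2) U by (auto simp: dist_commute)
  moreover have "m \<in> X \<inter> ball m e"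
    using mU e(1) by (simp add: super_def)
  ultimately have "X \<inter> ball m e \<subseteq> K"
    using mK by (intro components_maximal[OF K]) auto
  then have "y \<in> closure K" if "y \<in> X" "dist y m < e" for y
    using that closure_subset[of K] by (auto simp: dist_commute)
  then have "lower A y \<le> lower A m" if "y \<in> X" "dist y m < e" for y
    using m(2) that by blast
  then have "m \<in> maxima X A {c<..}"
    unfolding maxima_def local_max_def using mU cm e(1) by (auto simp: super_def)
  then show ?thesis
    using mK by blast
qed

text \<open>Each component holds a maximum above \<open>c\<close>, and these maxima form finitely
  many components, whose representatives then suffice. \<open>X\<close> and \<open>c\<close> are
  generalized because passing to a stratum changes both.\<close>

lemma finite_components_super:
  assumes "finite A" "affine X" "bounded (super X A c)"
  shows "finite (components (super X A c))"
  using assms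
proof (induction A arbitrary: X c rule: finite_psubset_induct)
  case (psubset A)
  show ?case
  proof (cases "A = {}")
    case True
    then have "connected (super X A c)"
      using psubset.prems(1) by (simp add: super_def affine_imp_convex convex_connected)
    \<comment> \<open>An inclusion rather than an equality also covers empty \<open>X\<close>, which
      has no components.\<close>
    then have "components (super X A c) \<subseteq> {super X A c}"
      by (metis components_empty components_eq_sing_iff empty_subsetI order_refl)
    then show ?thesis
      by (rule finite_subset) simp
  next
    case False
    note A = psubset.hyps False
    let ?U = "super X A c"
    let ?M = "maxima X A {c<..}"
    have U: "{y \<in> X. lower A y \<in> {c<..}} = ?U"
      by (auto simp: super_def lower_gr_iff[OF A])
    have "finite (components ?M)"
    proof (rule finite_components_maxima_step[OF A psubset.prems(1)])
      show "bounded {y \<in> X. lower A y \<in> {c<..}}"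
        unfolding U by (rule psubset.prems(2))
    qed (rule psubset.IH)
    then obtain R where R: "finite R" "R \<subseteq> ?M" "\<And>x. x \<in> ?M \<Longrightarrow> \<exists>y\<in>R. connected_component ?M x y"
      unfolding finite_components_iff by blast
    have MU: "?M \<subseteq> ?U"
      using U by (auto simp: maxima_def local_max_def)
    have "\<exists>y\<in>R. connected_component ?U x y" if x: "x \<in> ?U" for x
    proof -
      obtain m where m: "connected_component ?U x m" "m \<in> ?M"
        using component_contains_maximum[OF A psubset.prems componentsI[OF x]] by auto
      then obtain y where "y \<in> R" "connected_component ?M m y"
        using R(3) by blast
      then show ?thesis
        using m(1) connected_component_of_subset[OF _ MU] connected_component_trans by metis
    qed
    then show ?thesis
      unfolding finite_components_iff using R(1,2) MU by blast
  qed
qed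

theorem finite_components_maxima:
  assumes "finite A" "A \<noteq> {}" "affine X" "bounded {y \<in> X. lower A y \<in> J}"
  shows "finite (components (maxima X A J))"
proof (rule finite_components_maxima_step[OF assms])
  fix B Y c
  assume B: "B \<subset> A" "affine Y" "bounded (super Y B c)"
  have "finite B"
    using B(1) assms(1) by (metis finite_subset psubset_imp_subset)
  then show "finite (components (super Y B c))"
    using B(2,3) by (rule finite_components_super)
qed

end

section \<open>Convexity of the Euclidean norm\<close>

text \<open>This is the reverse triangle inequality for \<open>(1 + t) *\<^sub>R x\<close> and
  \<open>t *\<^sub>R y\<close>.\<close>

lemma norm_extrapolate:
  fixes x y :: "'a::real_normed_vector"
  assumes "0 \<le> t"
  shows "norm x + t * (norm x - norm y) \<le> norm (x + t *\<^sub>R (x - y))"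
proof -
  have "norm ((1 + t) *\<^sub>R x) - norm (t *\<^sub>R y) \<le> norm ((1 + t) *\<^sub>R x - t *\<^sub>R y)"
    by (rule norm_triangle_ineq2)
  moreover have "(1 + t) *\<^sub>R x - t *\<^sub>R y = x + t *\<^sub>R (x - y)"
    by (simp add: algebra_simps)
  moreover have "norm ((1 + t) *\<^sub>R x) = (1 + t) * norm x"
    using assms by (simp only: norm_scaleR abs_of_nonneg)
  ultimately show ?thesis
    using assms by (simp add: algebra_simps)
qed

text \<open>With v = x - y, equal norms give 2 (x . v) = |v|^2, so |x + t v|^2 exceeds |x|^2 by (t +
  t^2) |v|^2.\<close>

lemma norm_extrapolate_strict:
  fixes x y :: "'a::real_inner"
  assumes t: "0 < t" and eq: "norm x = norm y" and neq: "x \<noteq> y"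
  shows "norm x < norm (x + t *\<^sub>R (x - y))"
proof -
  let ?v = "x - y"
  have "x \<bullet> x = y \<bullet> y"
    using eq by (simp add: norm_eq)
  then have v: "2 * (x \<bullet> ?v) = ?v \<bullet> ?v"
    by (simp add: algebra_simps inner_commute)
  have pos: "?v \<bullet> ?v > 0"
    using neq by simp
  have "(x + t *\<^sub>R ?v) \<bullet> (x + t *\<^sub>R ?v) = x \<bullet> x + t * (2 * (x \<bullet> ?v)) + t\<^sup>2 * (?v \<bullet> ?v)"
    by (simp add: inner_add_left inner_add_right inner_commute power2_eq_square)
  also have "\<dots> > x \<bullet> x"
    unfolding v using t pos by (simp add: add_pos_pos)
  finally show ?thesis
    by (simp add: norm_lt)
qed

section \<open>Sphere packings as a convex family\<close>

text \<open>Constraints are indices rather than numbers, so those with equal gaps at a configuration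
  stay distinguishable in an active set.\<close>

datatype ('n, 'd) constraint = Dist 'n 'n | Low 'n 'd | High 'n 'd

primrec gap :: "('n, 'd) constraint \<Rightarrow> real ^ 'd ^ 'n \<Rightarrow> real" where
  "gap (Dist i j) x = norm (x $ i - x $ j) / 2"
| "gap (Low i k) x = x $ i $ k"
| "gap (High i k) x = 1 - x $ i $ k"

text \<open>\<open>vec\<close> turns a wall coordinate into a constant vector so that all
  projections share one type; \<open>High\<close> keeps the plain coordinate because projections
  must be linear.\<close>

primrec proj :: "('n, 'd) constraint \<Rightarrow> real ^ 'd ^ 'n \<Rightarrow> real ^ 'd" where
  "proj (Dist i j) x = x $ i - x $ j"
| "proj (Low i k) x = vec (x $ i $ k)"
| "proj (High i k) x = vec (x $ i $ k)"

definition constraints :: "('n, 'd) constraint set" where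
  "constraints = {Dist i j | i j. i \<noteq> j} \<union> {Low i k | i k. True} \<union> {High i k | i k. True}"

lemma finite_constraints: "finite (constraints :: ('n::finite, 'd::finite) constraint set)"
proof -
  have "constraints \<subseteq> case_prod Dist ` UNIV \<union> case_prod Low ` UNIV \<union> case_prod High ` UNIV"
    by (auto simp: constraints_def)
  then show ?thesis
    by (rule finite_subset) simp
qed

lemma constraints_nonempty: "constraints \<noteq> {}"
  by (auto simp: constraints_def)

lemma ball_constraints:
  "(\<forall>a\<in>constraints. Q a) \<longleftrightarrow>
    (\<forall>i j. i \<noteq> j \<longrightarrow> Q (Dist i j)) \<and> (\<forall>i k. Q (Low i k)) \<and> (\<forall>i k. Q (High i k))"
  by (auto simp: constraints_def)

interpretation packing: convex_family
  "gap :: ('n::finite, 'd::finite) constraint \<Rightarrow> _" proj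
proof (rule convex_family.intro)
  fix a :: "('n, 'd) constraint" and x y :: "real ^ 'd ^ 'n" and t :: real
  show "linear (proj a)"
    by (cases a) (auto intro!: linearI simp: vec_eq_iff algebra_simps)
  show "continuous_on UNIV (gap a)"
    by (cases a) (auto intro!: continuous_intros)
  show "proj a x = proj a y \<Longrightarrow> gap a x = gap a y"
    by (cases a) auto
  show "gap a x + t * (gap a x - gap a y) \<le> gap a (x + t *\<^sub>R (x - y))" if "0 \<le> t"
  proof (cases a)
    case (Dist i j)
    then show ?thesis
      using norm_extrapolate[OF that, of "x $ i - x $ j" "y $ i - y $ j"]
      by (simp add: algebra_simps)
  qed (simp_all add: algebra_simps)
  show "gap a x < gap a (x + t *\<^sub>R (x - y))"
    if "0 < t" "gap a x = gap a y" "proj a x \<noteq> proj a y"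
  proof (cases a)
    case (Dist i j)
    then show ?thesis
      using norm_extrapolate_strict[OF that(1), of "x $ i - x $ j" "y $ i - y $ j"] that(2,3)
      by (simp add: algebra_simps)
  \<comment> \<open>For a wall constraint equal gaps force equal projections, so the hypotheses
    contradict each other.\<close>
  qed (use that in auto)
qed

lemma max_radius_eq_lower:
  fixes x :: "real ^ 'd::finite ^ 'n::finite"
  shows "max_radius x = packing.lower constraints x"
proof -
  have "(\<lambda>a. gap a x) ` constraints = {norm (x $ i - x $ j) / 2 | i j. i \<noteq> j}
     \<union> {x $ i $ k | i k. True} \<union> {1 - x $ i $ k | i k. True}" (is "?L = ?R")
  proof
    show "?L \<subseteq> ?R"
    proof (rule image_subsetI)
      fix a :: "('n, 'd) constraint" assume "a \<in> constraints"
      then show "gap a x \<in> ?R"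
        by (cases a) (simp_all add: constraints_def del: eq_divide_eq_numeral1, blast+)
    qed
    show "?R \<subseteq> ?L"
    proof
      fix v assume "v \<in> ?R"
      then consider i j where "v = gap (Dist i j) x" "i \<noteq> j"
        | i k where "v = gap (Low i k) x" | i k where "v = gap (High i k) x"
        by (auto simp del: eq_divide_eq_numeral1)
      then show "v \<in> ?L"
        by cases (rule image_eqI, assumption, simp add: constraints_def)+
    qed
  qed
  then show ?thesis
    by (simp add: max_radius_def packing.lower_def)
qed

text \<open>The radius formula makes sense on the whole space, and some wall term is negative
  outside the cube. The walls thus become constraints like the others, and the ambient affine set
  can be \<open>UNIV\<close>.\<close>

lemma unit_cube_iff_max_radius: "x \<in> unit_cube \<longleftrightarrow> 0 \<le> max_radius x"
  unfolding max_radius_eq_lower packing.lower_ge_iff[OF finite_constraints constraints_nonempty]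
  by (auto simp: ball_constraints unit_cube_def)

text \<open>Points outside the cube have negative value and never beat a point of the cube, so
  comparing with all neighbours changes nothing.\<close>

lemma is_local_maximum_iff:
  fixes x :: "real ^ 'd::finite ^ 'n::finite"
  shows "is_local_maximum x \<longleftrightarrow> x \<in> packing.maxima UNIV constraints {0..}"
proof (cases "x \<in> unit_cube")
  case True
  have outside: "max_radius y \<le> max_radius x" if "y \<notin> unit_cube" for y :: "real ^ 'd ^ 'n"
    using True that unfolding unit_cube_iff_max_radius by simp
  have "(\<forall>y\<in>unit_cube. y \<noteq> x \<and> norm (y - x) < \<delta> \<longrightarrow> max_radius y \<le> max_radius x) \<longleftrightarrow>
      (\<forall>y\<in>UNIV. dist y x < \<delta> \<longrightarrow> max_radius y \<le> max_radius x)" for \<delta>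
    using outside unfolding dist_norm by (metis UNIV_I order_refl)
  then show ?thesis
    using True unit_cube_iff_max_radius[of x]
    by (simp add: is_local_maximum_def packing.maxima_def packing.local_max_def
        max_radius_eq_lower[symmetric])
next
  case False
  then show ?thesis
    using unit_cube_iff_max_radius[of x]
    by (simp add: is_local_maximum_def packing.maxima_def max_radius_eq_lower)
qed

lemma bounded_unit_cube: "bounded (unit_cube :: (real ^ 'd::finite ^ 'n::finite) set)"
proof (rule boundedI)
  fix x :: "real ^ 'd ^ 'n"
  assume x: "x \<in> unit_cube"
  have "norm x \<le> (\<Sum>i\<in>UNIV. norm (x $ i))"
    unfolding norm_vec_def by (rule L2_set_le_sum) simp
  also have "\<dots> \<le> (\<Sum>i\<in>UNIV. \<Sum>k\<in>UNIV. \<bar>x $ i $ k\<bar>)"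
    by (intro sum_mono norm_le_l1_cart)
  also have "\<dots> \<le> (\<Sum>i\<in>(UNIV :: 'n set). \<Sum>k\<in>(UNIV :: 'd set). 1)"
    using x by (intro sum_mono) (simp add: unit_cube_def)
  finally show "norm x \<le> (\<Sum>i\<in>(UNIV :: 'n set). \<Sum>k\<in>(UNIV :: 'd set). 1)" .
qed

theorem proposition1:
  assumes "CARD('n::finite) \<ge> 2" and "CARD('d::finite) \<ge> 2"
  shows "finite (max_radius ` {x :: real ^ 'd ^ 'n. is_local_maximum x}) \<and>
         finite (components {x :: real ^ 'd ^ 'n. is_local_maximum x})"
proof -
  let ?A = "constraints :: ('n, 'd) constraint set"
  have M: "{x :: real ^ 'd ^ 'n. is_local_maximum x} = packing.maxima UNIV ?A {0..}"
    by (auto simp: is_local_maximum_iff)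
  have R: "max_radius = packing.lower ?A"
    by (simp add: fun_eq_iff max_radius_eq_lower)
  \<comment> \<open>For \<open>J = {0..}\<close> the set required to be bounded is the cube
    itself.\<close>
  have "{y \<in> UNIV. packing.lower ?A y \<in> {0..}} = unit_cube"
    by (auto simp: unit_cube_iff_max_radius max_radius_eq_lower)
  then have "bounded {y \<in> UNIV. packing.lower ?A y \<in> {0..}}"
    using bounded_unit_cube by metis
  then show ?thesis
    unfolding M R
    by (intro conjI packing.finite_maximal_values packing.finite_components_maxima
        finite_constraints constraints_nonempty affine_UNIV)
qed

end
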